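(* Let $\mathbb{N}_\infty=\mathbb{N}_0\cup\{\infty\}$ be the one-point compactification of the discrete space $\mathbb{N}_0=\{0,1,2,\dots\}$ and let $\varrho\colon\mathbb{N}_\infty\to(\mathbb{N}_\infty)^\ast$ be the substitution $$\varrho(0)=1,\qquad \varrho(1)=2,\qquad \varrho(a)=0\ (a-2)\ (a+1)\ \text{ for } 2\le a<\infty,\qquad \varrho(\infty)=0\,\infty\,\infty .$$ Let $\alpha=39/20=1.95<2$. Then: (i) for every $a\in\mathbb{N}_0$ there exists a constant $c=c_a\ge 1$ such that $\#\varrho^n(a)\le c\,\alpha^n$ for all $n\in\mathbb{N}_0$; (ii) in contrast, $\#\varrho^n(\infty)\ge 2^n$ for all $n\in\mathbb{N}_0$; (iii) $\varrho$ is primitive. Thus $\varrho$ is a primitive substitution on $\mathbb{N}_\infty$ that does not admit a natural length function and whose subshift $X$ is not uniquely ergodic.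
   Context: For a non-empty compact Hausdorff space $\mathcal{A}$ (alphabet; here $\mathcal{A}=\mathbb{N}_\infty$), $\mathcal{A}^\ast = \bigsqcup_{i\ge 0}\mathcal{A}^i$ is the space of finite words (product topologies, disjoint union topology). $\#u$ is the length of a word $u$; $v\triangleleft u$ means that $v$ is a (contiguous) subword of the finite or bi-infinite word $u$. A substitution is a continuous map $\varrho\colon\mathcal{A}\to\mathcal{A}^\ast$, extended to $\mathcal{A}^\ast\to\mathcal{A}^\ast$ by concatenation so that it can be iterated. $\varrho$ is primitive if for every non-empty open $U\subseteq\mathcal{A}$ there is $n=n_U$ such that for all $a\in\mathcal{A}$ the word $\varrho^n(a)$ contains a letter in $U$. The language $\mathcal{L}(\varrho)$ is the closure in $\mathcal{A}^\ast$ of the set of words $u$ with $u\triangleleft\varrho^n(a)$ for some $n\in\mathbb{N}_0$, $a\in\mathcal{A}$. The subshift is $X=\{w\in\mathcal{A}^{\mathbb{Z}} : \text{every finite } u\triangleleft w \text{ lies in } \mathcal{L}(\varrho)\}$ (subspace of the product topology), with left shift $\sigma$. A measure on $X$ is a positive continuous linear functional $\mu$ on $C(X)$ (real continuous functions, sup norm); it is a probability measure if $\mu(\mathbf{1})=1$ and $\sigma$-invariant if $\mu(f\circ\sigma)=\mu(f)$ for all $f\in C(X)$. $X$ is uniquely ergodic if it has exactly one $\sigma$-invariant probability measure. With $E=C(\mathcal{A})$ (real continuous functions), the substitution operator is $(Mf)(a)=\sum_{b\triangleleft\varrho(a)}f(b)$ (sum over letters of $\varrho(a)$ with multiplicity).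 A natural length function is a non-zero, non-negative $\ell\in E$ with $M\ell=\lambda\ell$ for some $\lambda\ge 0$. *)

theory Defs
  imports "HOL-Analysis.Analysis" "HOL-Library.Sublist"
begin

section \<open>Finite words and substitutions\<close>

text \<open>
  Finite words over an alphabet are lists. A word \<open>u\<close> is identified with the pair of its length
  and the tuple of its letters, so that the topology below is the disjoint union, over
  all lengths \<open>n\<close>, of the product topologies on \<open>n\<close>-tuples.
\<close>

definition word_topology :: "'a::topological_space list topology" where
  "word_topology =
     pullback_topology UNIV (\<lambda>u. (length u, restrict ((!) u) {..<length u}))
       (sum_topology (\<lambda>n. product_topology (\<lambda>_. euclidean) {..<n}) (UNIV :: nat set))"

definition substitution :: "('a::t2_space \<Rightarrow> 'a list) \<Rightarrow> bool" where
  "substitution \<rho> \<longleftrightarrow> compact (UNIV :: 'a set) \<and> continuous_map euclidean word_topology \<rho>"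

definition subst_ext :: "('a \<Rightarrow> 'a list) \<Rightarrow> 'a list \<Rightarrow> 'a list" where
  "subst_ext \<rho> u = concat (map \<rho> u)"

definition subst_iter :: "('a \<Rightarrow> 'a list) \<Rightarrow> nat \<Rightarrow> 'a \<Rightarrow> 'a list" where
  "subst_iter \<rho> n a = (subst_ext \<rho> ^^ n) [a]"

definition primitive :: "('a::topological_space \<Rightarrow> 'a list) \<Rightarrow> bool" where
  "primitive \<rho> \<longleftrightarrow>
     (\<forall>U. open U \<and> U \<noteq> {} \<longrightarrow> (\<exists>n. \<forall>a. set (subst_iter \<rho> n a) \<inter> U \<noteq> {}))"


section \<open>Language and subshift\<close>

definition language :: "('a::topological_space \<Rightarrow> 'a list) \<Rightarrow> 'a list set" where
  "language \<rho> = word_topology closure_of {u. \<exists>n a. sublist u (subst_iter \<rho> n a)}"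

definition subword_of_biinf :: "'a list \<Rightarrow> (int \<Rightarrow> 'a) \<Rightarrow> bool" where
  "subword_of_biinf u w \<longleftrightarrow> (\<exists>i. \<forall>k<length u. u ! k = w (i + int k))"

definition subshift :: "('a::topological_space \<Rightarrow> 'a list) \<Rightarrow> (int \<Rightarrow> 'a) set" where
  "subshift \<rho> = {w. \<forall>u. subword_of_biinf u w \<longrightarrow> u \<in> language \<rho>}"

definition shift :: "(int \<Rightarrow> 'a) \<Rightarrow> (int \<Rightarrow> 'a)" where
  "shift w = (\<lambda>k. w (k + 1))"


section \<open>Invariant measures as functionals\<close>

text \<open>
  For a compact set \<open>X\<close> this is \<open>C(X)\<close> with the sup metric. Its elements are real functions on the
  whole type that are continuous on \<open>X\<close> and take the fixed value \<^const>\<open>undefined\<close> outside \<open>X\<close>;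
  this makes them correspond bijectively to the continuous functions on \<open>X\<close>, and is the reason
  for the applications of \<^const>\<open>restrict\<close> below. The requirement in \<^const>\<open>cfunspace\<close> that the functions be
  bounded is automatic for compact \<open>X\<close>. The type \<open>int \<Rightarrow> 'a\<close> carries the product topology.
\<close>

definition C_space :: "'b::topological_space set \<Rightarrow> ('b \<Rightarrow> real) metric" where
  "C_space X = cfunspace (top_of_set X) euclidean_metric"

text \<open>
  A functional on \<open>C(X)\<close> is likewise required to be \<^const>\<open>extensional\<close>, so that two functionals
  are equal as soon as they agree on \<open>C(X)\<close>.
\<close>

definition measure_functional :: "'b::topological_space set \<Rightarrow> (('b \<Rightarrow> real) \<Rightarrow> real) \<Rightarrow> bool" where
  "measure_functional X \<mu> \<longleftrightarrow>
     \<mu> \<in> extensional (mspace (C_space X)) \<and>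
     (\<forall>f\<in>mspace (C_space X). \<forall>g\<in>mspace (C_space X).
        \<mu> (restrict (\<lambda>x. f x + g x) X) = \<mu> f + \<mu> g) \<and>
     (\<forall>c. \<forall>f\<in>mspace (C_space X). \<mu> (restrict (\<lambda>x. c * f x) X) = c * \<mu> f) \<and>
     (\<forall>f\<in>mspace (C_space X). (\<forall>x\<in>X. 0 \<le> f x) \<longrightarrow> 0 \<le> \<mu> f) \<and>
     continuous_map (mtopology_of (C_space X)) euclideanreal \<mu>"

definition invariant_prob :: "(int \<Rightarrow> 'a::topological_space) set \<Rightarrow> (((int \<Rightarrow> 'a) \<Rightarrow> real) \<Rightarrow> real) \<Rightarrow> bool" where
  "invariant_prob X \<mu> \<longleftrightarrow>
     measure_functional X \<mu> \<and>
     \<mu> (restrict (\<lambda>x. 1) X) = 1 \<and>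
     (\<forall>f\<in>mspace (C_space X). \<mu> (restrict (f \<circ> shift) X) = \<mu> f)"

definition uniquely_ergodic :: "(int \<Rightarrow> 'a::topological_space) set \<Rightarrow> bool" where
  "uniquely_ergodic X \<longleftrightarrow> (\<exists>!\<mu>. invariant_prob X \<mu>)"


section \<open>Natural length functions\<close>

definition subst_operator :: "('a \<Rightarrow> 'a list) \<Rightarrow> ('a \<Rightarrow> real) \<Rightarrow> 'a \<Rightarrow> real" where
  "subst_operator \<rho> f a = (\<Sum>b\<leftarrow>\<rho> a. f b)"

definition natural_length_function :: "('a::topological_space \<Rightarrow> 'a list) \<Rightarrow> ('a \<Rightarrow> real) \<Rightarrow> bool" where
  "natural_length_function \<rho> l \<longleftrightarrow>
     continuous_on UNIV l \<and> l \<noteq> (\<lambda>a. 0) \<and> (\<forall>a. 0 \<le> l a) \<and>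
     (\<exists>lam\<ge>0. subst_operator \<rho> l = (\<lambda>a. lam * l a))"


section \<open>The substitution\<close>

text \<open>
  The order topology on \<^typ>\<open>enat\<close> is that of the one-point compactification of the discrete
  naturals: the finite points are isolated and the neighbourhoods of \<open>\<infinity>\<close> are the cofinite sets
  containing it (see \<open>open_enat_iff\<close>).
\<close>

definition rho :: "enat \<Rightarrow> enat list" where
  "rho x = (case x of
       enat a \<Rightarrow> if a = 0 then [1] else if a = 1 then [2] else [0, enat (a - 2), enat (a + 1)]
     | \<infinity> \<Rightarrow> [0, \<infinity>, \<infinity>])"

lemma rho_simps:
  "rho 0 = [1]"
  "rho 1 = [2]"
  "2 \<le> a \<Longrightarrow> rho (enat a) = [0, enat (a - 2), enat (a + 1)]"
  "rho \<infinity> = [0, \<infinity>, \<infinity>]"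
  by (simp_all add: rho_def zero_enat_def one_enat_def)

end

theory Submission
  imports Defs
begin

text \<open>
  A weight \<open>h \<ge> 1\<close> on the finite letters with \<open>M h \<le> \<alpha> h\<close> gives the growth bound on \<open>\<rho>\<^sup>n(a)\<close>, while
  \<open>\<rho>\<^sup>n(\<infinity>)\<close> contains \<open>2\<^sup>n\<close> letters \<open>\<infinity>\<close>. A natural length function that is positive at \<open>\<infinity>\<close> has
  \<open>\<lambda> \<ge> 2\<close> and hence vanishes at every finite letter, so it vanishes by continuity; if it vanishes
  at \<open>\<infinity>\<close>, then \<open>M \<ell> = \<lambda> \<ell>\<close> propagates the zero to \<open>0, 1, 2, \<dots>\<close>.

  For unique ergodicity consider \<open>g(x) = #\<rho>(x\<^sub>0)\<close>. Its average over an occurrence of \<open>\<rho>\<^sup>n(a)\<close> in a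
  point of the subshift is the ratio of the lengths of two consecutive iterates. For \<open>a = \<infinity>\<close> this
  ratio is infinitely often at least \<open>1.99\<close>, for \<open>a = 0\<close> infinitely often at most \<open>1.96\<close>, and limits
  of the empirical measures are two invariant measures that assign different integrals to \<open>g\<close>.
\<close>

section \<open>Iterated substitutions\<close>

lemma subst_ext_funpow_append:
  "(subst_ext \<rho> ^^ n) (u @ v) = (subst_ext \<rho> ^^ n) u @ (subst_ext \<rho> ^^ n) v"
  by (induction n) (auto simp: subst_ext_def)

lemma subst_ext_funpow: "(subst_ext \<rho> ^^ n) u = concat (map (subst_iter \<rho> n) u)"
proof (induction u)
  case Nil
  show ?case by (induction n) (auto simp: subst_ext_def)
next
  case (Cons a u)
  then show ?case
    using subst_ext_funpow_append[of n \<rho> "[a]" u] by (simp add: subst_iter_def)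
qed

lemma subst_iter_0 [simp]: "subst_iter \<rho> 0 a = [a]"
  by (simp add: subst_iter_def)

lemma subst_iter_add:
  "subst_iter \<rho> (m + n) a = concat (map (subst_iter \<rho> m) (subst_iter \<rho> n a))"
  by (simp add: subst_iter_def[of _ "m + n"] funpow_add subst_ext_funpow flip: subst_iter_def)

lemma subst_iter_1 [simp]: "subst_iter \<rho> (Suc 0) a = \<rho> a"
  by (simp add: subst_iter_def subst_ext_def)

lemma subst_iter_Suc: "subst_iter \<rho> (Suc n) a = concat (map (subst_iter \<rho> n) (\<rho> a))"
  using subst_iter_add[of \<rho> n 1 a] by simp

lemma subst_iter_Suc': "subst_iter \<rho> (Suc n) a = concat (map \<rho> (subst_iter \<rho> n a))"
  using subst_iter_add[of \<rho> 1 n a] by (simp add: subst_iter_1[abs_def])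

lemma set_subst_iter_trans:
  assumes "b \<in> set (subst_iter \<rho> n a)" "c \<in> set (subst_iter \<rho> m b)"
  shows "c \<in> set (subst_iter \<rho> (m + n) a)"
  using assms by (auto simp: subst_iter_add)

lemma sum_list_concat_map:
  "(\<Sum>b\<leftarrow>concat (map g u). f b) = (\<Sum>a\<leftarrow>u. \<Sum>b\<leftarrow>g a. f b)"
  by (induction u) auto

text \<open>The left side is \<open>M^n f\<close> evaluated at \<open>a\<close>, so an eigenfunction
  is only scaled. This turns growth of the eigenvalue powers into growth of lengths.\<close>

lemma sum_list_subst_iter_eigenfunction:
  assumes "subst_operator \<rho> f = (\<lambda>a. lam * f a)"
  shows "(\<Sum>b\<leftarrow>subst_iter \<rho> n a. f b) = lam ^ n * f a"
proof (induction n)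
  case (Suc n)
  have "(\<Sum>b\<leftarrow>\<rho> a. f b) = lam * f a" for a
    using fun_cong[OF assms, of a] by (simp add: subst_operator_def)
  then have "(\<Sum>b\<leftarrow>subst_iter \<rho> (Suc n) a. f b) = (\<Sum>b\<leftarrow>subst_iter \<rho> n a. lam * f b)"
    by (simp add: subst_iter_Suc' sum_list_concat_map)
  with Suc show ?case by (simp add: sum_list_const_mult)
qed simp

section \<open>The space of words and the substitution\<close>

lemma topspace_word_topology [simp]: "topspace word_topology = UNIV"
  by (auto simp: word_topology_def topspace_pullback_topology)

lemma rho_0: "rho 0 = [1]" and rho_1: "rho 1 = [2]" and rho_infinity: "rho \<infinity> = [0, \<infinity>, \<infinity>]"
  by (simp_all add: rho_simps)

lemma rho_0': "rho (enat 0) = [enat 1]" and rho_1': "rho (enat 1) = [enat 2]"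
  by (simp_all add: rho_def one_enat_def numeral_eq_enat)

lemma rho_ge_2: "2 \<le> a \<Longrightarrow> rho (enat a) = [enat 0, enat (a - 2), enat (a + 1)]"
  by (simp add: rho_simps zero_enat_def)

text \<open>Finite letters are isolated, so continuity matters only at \<infinity>. There the three
  letters of \<open>[0, a - 2, a + 1]\<close> converge to those of
  \<open>[0, \<infinity>, \<infinity>]\<close>.\<close>

lemma substitution_rho: "substitution rho"
proof -
  have "open {x. rho x \<in> W}" if W: "openin word_topology W" for W
    unfolding open_enat_iff
  proof (intro impI)
    assume "\<infinity> \<in> {x. rho x \<in> W}"
    then have infW: "[0, \<infinity>, \<infinity>] \<in> W" by (simp add: rho_infinity)
    obtain S where
      S: "openin (sum_topology (\<lambda>n. product_topology (\<lambda>_. euclidean) {..<n}) (UNIV :: nat set)) S"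
      and WS: "\<And>u. u \<in> W \<longleftrightarrow> (length u, restrict ((!) u) {..<length u}) \<in> S"
      using W by (auto simp: word_topology_def openin_pullback_topology)
    \<comment> \<open>Images of letters near \<infinity> have length 3, so only this summand of the
      disjoint union counts.\<close>
    have open3: "openin (product_topology (\<lambda>_. euclidean) {..<3}) {x. (3::nat, x) \<in> S}"
      using S by (auto simp: openin_sum_topology)
    have mem: "restrict ((!) [0, \<infinity>, \<infinity>]) {..<3} \<in> {x. (3::nat, x) \<in> S}"
      using infW by (simp add: WS eval_nat_numeral)
    obtain U where U: "\<And>i. i \<in> {..<3} \<Longrightarrow> open (U i)"
      and inU: "restrict ((!) [0, \<infinity>, \<infinity>]) {..<3} \<in> Pi\<^sub>E {..<3::nat} U"
      and US: "Pi\<^sub>E {..<3} U \<subseteq> {x. (3::nat, x) \<in> S}"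
      using open3[unfolded openin_product_topology_alt, rule_format, OF mem]
      by (auto simp flip: open_openin)
    have U0: "0 \<in> U 0" and U1: "\<infinity> \<in> U 1" and U2: "\<infinity> \<in> U 2"
      using inU[THEN PiE_mem, of 0] inU[THEN PiE_mem, of 1] inU[THEN PiE_mem, of 2] by auto
    obtain n1 where n1: "{enat n1<..} \<subseteq> U 1" using U[of 1] U1 by (auto simp: open_enat_iff)
    obtain n2 where n2: "{enat n2<..} \<subseteq> U 2" using U[of 2] U2 by (auto simp: open_enat_iff)
    \<comment> \<open>The bound ensures \<open>a - 2 > n1\<close>, \<open>a + 1 > n2\<close> and the
      third clause of \<open>rho\<close>.\<close>
    have "rho x \<in> W" if x: "enat (n1 + n2 + 2) < x" for x
    proof (cases x)
      case (enat a)
      then have a: "n1 + n2 + 2 < a" using x by simp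
      then have r: "rho x = [0, enat (a - 2), enat (a + 1)]" using enat by (simp add: rho_simps)
      have "restrict ((!) (rho x)) {..<3} \<in> Pi\<^sub>E {..<3::nat} U"
      proof (rule restrict_PiE_iff[THEN iffD2], rule ballI)
        fix i :: nat assume "i \<in> {..<3}"
        then consider "i = 0" | "i = 1" | "i = 2" by fastforce
        then show "rho x ! i \<in> U i"
        proof cases
          case 1
          then show ?thesis using U0 r by simp
        next
          case 2
          moreover have "enat (a - 2) \<in> U 1" using a n1 by (intro subsetD[OF n1]) simp
          ultimately show ?thesis using r by simp
        next
          case 3
          moreover have "enat (a + 1) \<in> U 2" using a n2 by (intro subsetD[OF n2]) simp
          ultimately show ?thesis using r by simp
        qed
      qed
      then have "(3, restrict ((!) (rho x)) {..<3}) \<in> S" using US by blast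
      then show ?thesis using r by (simp add: WS eval_nat_numeral)
    next
      case infinity
      then show ?thesis using infW by (simp add: rho_infinity)
    qed
    then show "\<exists>n::nat. {enat n<..} \<subseteq> {x. rho x \<in> W}"
      by (intro exI[of _ "n1 + n2 + 2"]) auto
  qed
  then have "continuous_map euclidean word_topology rho"
    by (simp add: continuous_map_def flip: open_openin)
  then show ?thesis by (simp add: substitution_def compact_UNIV)
qed

section \<open>Growth of the iterates\<close>

text \<open>
  A supersolution \<open>M h \<le> \<alpha> h\<close>: the tail is geometric with a ratio \<open>x\<close> near the minimiser of
  \<open>x + 1 / x\<^sup>2\<close>, where this expression is smaller than \<open>\<alpha>\<close>, and the initial values keep
  \<open>h\<close> as large as the inequality allows, so that the letter \<open>0\<close> can be absorbed by the tail.
\<close>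
definition weight :: "nat \<Rightarrow> real" where
  "weight a =
    (if a < 9 then [1, 19/10, 37/10, 26/5, 36/5, 93/10, 119/10, 15, 189/10] ! a
     else 239/10 * (63/50) ^ (a - 9))"

lemma weight_ge_1: "1 \<le> weight a"
proof (cases "a < 9")
  case True
  then consider "a = 0" | "a = 1" | "a = 2" | "a = 3" | "a = 4" | "a = 5" | "a = 6" | "a = 7" | "a = 8"
    by linarith
  then show ?thesis by cases (simp_all add: weight_def)
next
  case False
  have "1 \<le> (63/50::real) ^ (a - 9)" by (rule one_le_power) simp
  then have "1 \<le> 239/10 * (63/50::real) ^ (a - 9)" by linarith
  then show ?thesis using False by (simp add: weight_def)
qed

text \<open>All three letters other than the extra 0 lie in the geometric tail once
  \<open>a - 2 \<ge> 9\<close>; the values \<open>a = 2, ..., 10\<close> are checked one by one. In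
  the tail, division by \<open>t\<close> reduces the claim to one numerical inequality.\<close>

lemma weight_step:
  assumes "2 \<le> a"
  shows "weight 0 + weight (a - 2) + weight (a + 1) \<le> 39/20 * weight a"
proof (cases "a < 11")
  case True
  with assms consider "a = 2" | "a = 3" | "a = 4" | "a = 5" | "a = 6" | "a = 7" | "a = 8" | "a = 9"
    | "a = 10" by linarith
  then show ?thesis by cases (simp_all add: weight_def power2_eq_square)
next
  case False
  define t :: real where "t = (63/50) ^ (a - 11)"
  have "a - 9 = a - 11 + 2" "a + 1 - 9 = a - 11 + 3" "a - 2 - 9 = a - 11" using False by auto
  then have "weight a = 239/10 * t * (63/50)^2" "weight (a + 1) = 239/10 * t * (63/50)^3"
    "weight (a - 2) = 239/10 * t" "weight 0 = 1"
    using False by (simp_all only: weight_def t_def power_add) auto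
  \<comment> \<open>This absorbs the weight 1 of the letter 0 into the slack of the tail.\<close>
  moreover have "1 \<le> t" unfolding t_def by (rule one_le_power) simp
  ultimately show ?thesis by (simp add: power2_eq_square power3_eq_cube)
qed

text \<open>Finite letters produce only finite letters, so peeling off the first substitution gives
  \<open>(M weight)(a)\<close> times the bound for \<open>n\<close>. The letters 0 and 1 need
  \<open>weight 1 \<le> 39/20 * weight 0\<close> and
  \<open>weight 2 \<le> 39/20 * weight 1\<close>.\<close>

lemma length_subst_iter_finite:
  "real (length (subst_iter rho n (enat a))) \<le> weight a * (39/20) ^ n"
proof (induction n arbitrary: a)
  case 0
  then show ?case by (simp add: weight_ge_1)
next
  case (Suc n)
  consider "a = 0" | "a = 1" | "2 \<le> a" by linarith
  then show ?case
  proof cases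
    case 1
    then show ?thesis using Suc[of 1] by (simp add: subst_iter_Suc rho_0' weight_def)
  next
    case 2
    then have "real (length (subst_iter rho (Suc n) (enat a))) \<le> weight 2 * (39/20) ^ n"
      using Suc[of 2] rho_1' by (simp add: subst_iter_Suc)
    also have "\<dots> \<le> (39/20 * weight 1) * (39/20) ^ n"
      by (intro mult_right_mono) (simp_all add: weight_def)
    finally show ?thesis using 2 by (simp add: mult_ac)
  next
    case 3
    have "real (length (subst_iter rho (Suc n) (enat a)))
        \<le> (weight 0 + weight (a - 2) + weight (a + 1)) * (39/20) ^ n"
      using Suc[of 0] Suc[of "a - 2"] Suc[of "a + 1"] 3
      by (simp add: subst_iter_Suc rho_ge_2 distrib_right)
    also have "\<dots> \<le> (39/20 * weight a) * (39/20) ^ n"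
      by (intro mult_right_mono weight_step 3) simp
    finally show ?thesis by (simp add: mult_ac)
  qed
qed

section \<open>Lower bounds for the lengths of iterates\<close>

lemma subst_iter_infinity_Suc:
  "subst_iter rho (Suc n) \<infinity> = subst_iter rho n 0 @ subst_iter rho n \<infinity> @ subst_iter rho n \<infinity>"
  by (simp add: subst_iter_Suc rho_infinity)

lemma length_subst_iter_infinity: "2 ^ n \<le> length (subst_iter rho n \<infinity>)"
  by (induction n) (simp_all add: subst_iter_infinity_Suc)

lemma subst_iter_3_0: "subst_iter rho 3 0 = [0, 0, 3]"
proof -
  have "rho 2 = [0, 0, 3]"
    using rho_ge_2[of 2] by (simp add: zero_enat_def numeral_eq_enat)
  then show ?thesis
    by (simp add: numeral_3_eq_3 subst_iter_Suc rho_0 rho_1)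
qed

lemma subst_iter_nonempty: "subst_iter rho n a \<noteq> []"
proof (induction n arbitrary: a)
  case (Suc n)
  have "rho a \<noteq> []" by (auto simp: rho_def split: enat.split)
  then obtain b u where "rho a = b # u" by (cases "rho a") auto
  then show ?case using Suc by (simp add: subst_iter_Suc)
qed simp

text \<open>Since \<open>rho^3(0)\<close> starts with \<open>0 0\<close>, three further
  substitutions add at least one letter. The bound serves only to show that the lengths tend to
  infinity.\<close>

lemma length_subst_iter_0_lower: "n \<le> 3 * length (subst_iter rho n 0)"
proof (induction n rule: less_induct)
  case (less n)
  have pos: "1 \<le> length (subst_iter rho m a)" for m a
    using subst_iter_nonempty[of m a] by (simp add: Suc_leI)
  show ?case
  proof (cases "n < 3")
    case True
    then show ?thesis using pos[of n 0] by linarith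
  next
    case False
    have "subst_iter rho n 0 =
        subst_iter rho (n - 3) 0 @ subst_iter rho (n - 3) 0 @ subst_iter rho (n - 3) 3"
      using subst_iter_add[of rho "n - 3" 3 0] False by (simp add: subst_iter_3_0)
    then show ?thesis using less[of "n - 3"] pos[of "n - 3" 0] False by simp
  qed
qed

section \<open>Primitivity and natural length functions\<close>

text \<open>The image of each finite letter \<open>m\<close> contains \<open>m + 1\<close>.\<close>

lemma mem_subst_iter_0: "enat m \<in> set (subst_iter rho m 0)"
proof (induction m)
  case 0
  then show ?case by (simp add: zero_enat_def)
next
  case (Suc m)
  consider "m = 0" | "m = 1" | "2 \<le> m" by linarith
  then have "enat (Suc m) \<in> set (rho (enat m))"
    using rho_1' by cases (simp_all add: rho_0' rho_ge_2 numeral_2_eq_2)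
  then show ?case using Suc by (auto simp: subst_iter_Suc')
qed

text \<open>The return times \<open>3\<close> and \<open>4\<close> of the letter \<open>0\<close> generate all integers \<open>n \<ge> 6\<close>.\<close>
lemma zero_mem_subst_iter_0:
  assumes "6 \<le> n"
  shows "0 \<in> set (subst_iter rho n 0)"
  using assms
proof (induction n rule: less_induct)
  case (less n)
  have r3: "0 \<in> set (subst_iter rho 3 0)" by (simp add: subst_iter_3_0)
  have "rho 3 = [0, 1, 4]"
    using rho_ge_2[of 3] by (simp add: zero_enat_def one_enat_def numeral_eq_enat)
  then have "subst_iter rho (Suc 3) 0 = [1, 1, 0, 1, 4]"
    by (simp only: subst_iter_Suc' subst_iter_3_0) (simp add: rho_0)
  then have r4: "0 \<in> set (subst_iter rho 4 0)" by simp
  \<comment> \<open>The values 6, 7, 8 start an induction with step 3.\<close>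
  consider "n = 3 + 3" | "n = 3 + 4" | "n = 4 + 4" | "9 \<le> n" using less.prems by linarith
  then show ?case
  proof cases
    case 4
    then have "0 \<in> set (subst_iter rho (n - 3) 0)" using less by simp
    from set_subst_iter_trans[OF r3 this] show ?thesis using 4 by simp
  qed (use set_subst_iter_trans[OF r3 r3] set_subst_iter_trans[OF r4 r3]
      set_subst_iter_trans[OF r4 r4] in simp_all)
qed

text \<open>Every letter yields a 0 after at most two substitutions, the slowest being 1, with
  \<open>1 -> 2 -> 0 0 3\<close>. At least six substitutions then remain, whence the uniform bound
  8.\<close>

lemma zero_mem_subst_iter:
  assumes "8 \<le> n"
  shows "0 \<in> set (subst_iter rho n a)"
proof -
  have "\<exists>k\<le>2. 0 \<in> set (subst_iter rho k a)"
  proof (cases a)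
    case (enat b)
    consider "b = 0" | "b = 1" | "2 \<le> b" by linarith
    then show ?thesis
    proof cases
      case 1
      then show ?thesis using enat by (intro exI[of _ 0]) (simp add: zero_enat_def)
    next
      case 2
      have "0 \<in> set (subst_iter rho 2 (enat 1))"
        using rho_1' rho_ge_2[of 2] by (simp add: numeral_2_eq_2 subst_iter_Suc zero_enat_def)
      then show ?thesis using 2 enat by blast
    next
      case 3
      then show ?thesis using enat by (intro exI[of _ 1]) (simp add: rho_ge_2 zero_enat_def)
    qed
  next
    case infinity
    then show ?thesis by (intro exI[of _ 1]) (simp add: rho_infinity)
  qed
  then obtain k where k: "k \<le> 2" "0 \<in> set (subst_iter rho k a)" by blast
  have "0 \<in> set (subst_iter rho (n - k) 0)" using k assms by (intro zero_mem_subst_iter_0) simp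
  from set_subst_iter_trans[OF k(2) this] show ?thesis using k assms by simp
qed

text \<open>Finite letters are dense, so \<open>U\<close> contains some \<open>m\<close>. Every
  letter reaches 0 in exactly 8 steps and 0 reaches \<open>m\<close> in \<open>m\<close>
  more.\<close>

lemma primitive_rho: "primitive rho"
  unfolding primitive_def
proof (intro allI impI)
  fix U :: "enat set" assume U: "open U \<and> U \<noteq> {}"
  have "\<exists>m. enat m \<in> U"
  proof (cases "\<infinity> \<in> U")
    case True
    then obtain n where "{enat n<..} \<subseteq> U" using U by (auto simp: open_enat_iff)
    then have "enat (Suc n) \<in> U" by auto
    then show ?thesis ..
  next
    case False
    then show ?thesis using U by (metis all_not_in_conv not_infinity_eq)
  qed
  then obtain m where m: "enat m \<in> U" ..
  have "enat m \<in> set (subst_iter rho (m + 8) a)" for a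
    using set_subst_iter_trans[OF zero_mem_subst_iter[OF order_refl] mem_subst_iter_0] .
  then show "\<exists>n. \<forall>a. set (subst_iter rho n a) \<inter> U \<noteq> {}" using m by blast
qed

section \<open>Absence of a natural length function\<close>

lemma no_exponential_domination:
  fixes q r c d :: real
  assumes "0 < q" "q < r" "0 < c"
  obtains n where "d * q ^ n < c * r ^ n"
proof -
  have "1 < r / q" using assms by simp
  then obtain n where n: "d / c < (r / q) ^ n" using real_arch_pow by blast
  then have "d * q ^ n < c * r ^ n" using assms by (simp add: power_divide field_simps)
  then show ?thesis by (rule that)
qed

lemma no_natural_length_function: "\<not> natural_length_function rho l"
proof
  assume "natural_length_function rho l"
  then obtain lam where cont: "continuous_on UNIV l" and nz: "l \<noteq> (\<lambda>a. 0)"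
    and nn: "\<And>a. 0 \<le> l a" and lam: "0 \<le> lam" and eig: "subst_operator rho l = (\<lambda>a. lam * l a)"
    by (auto simp: natural_length_function_def)
  have M: "(\<Sum>b\<leftarrow>rho a. l b) = lam * l a" for a
    using fun_cong[OF eig, of a] by (simp add: subst_operator_def)
  have fin: "l (enat a) = 0" for a
  proof (cases "l \<infinity> = 0")
    case True
    have z: "l 0 = 0"
      using M[of \<infinity>] True by (simp add: rho_infinity)
    show ?thesis
    proof (induction a)
      case 0
      then show ?case using z by (simp add: zero_enat_def)
    next
      case (Suc a)
      consider "a = 0" | "a = 1" | "2 \<le> a" by linarith
      then show ?case
      proof cases
        case 1
        then show ?thesis using M[of "enat 0"] Suc by (simp add: rho_0')
      next
        case 2
        then show ?thesis using M[of "enat 1"] Suc rho_1' by (simp add: numeral_2_eq_2)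
      next
        \<comment> \<open>As \<open>l\<close> is non-negative, a zero at \<open>a\<close> forces
          zeros at all letters of \<open>rho a\<close>, among them \<open>a + 1\<close>.\<close>
        case 3
        then show ?thesis
          using M[of "enat a"] Suc nn[of "enat 0"] nn[of "enat (a - 2)"] nn[of "enat (Suc a)"]
          by (simp add: rho_ge_2)
      qed
    qed
  next
    case False
    then have pos: "0 < l \<infinity>" using nn[of \<infinity>] by simp
    have "l 0 + 2 * l \<infinity> = lam * l \<infinity>" using M[of \<infinity>] by (simp add: rho_infinity)
    then have "2 * l \<infinity> \<le> lam * l \<infinity>" using nn[of 0] by simp
    then have lam2: "2 \<le> lam" using pos by simp
    have "bounded (range l)"
      using compact_continuous_image[OF cont compact_UNIV] by (rule compact_imp_bounded)
    then obtain B where "\<forall>x\<in>range l. norm x \<le> B" unfolding bounded_iff by blast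
    then have B: "l x \<le> B" for x by (simp add: abs_le_iff)
    have B0: "0 \<le> B" by (rule order_trans[OF nn B])
    show ?thesis
    proof (rule ccontr)
      assume "l (enat a) \<noteq> 0"
      then have la: "0 < l (enat a)" using nn[of "enat a"] by simp
      \<comment> \<open>The sum of \<open>l\<close> over \<open>rho^n(a)\<close> equals
        \<open>lam ^ n * l a\<close>, with \<open>lam \<ge> 2\<close>, but is at most
        \<open>B\<close> times a length of order \<open>(39/20) ^ n\<close>.\<close>
      obtain n where n: "(B * weight a) * (39/20) ^ n < l (enat a) * 2 ^ n"
        using no_exponential_domination[of "39/20" 2 "l (enat a)" "B * weight a"] la by auto
      have "l (enat a) * 2 ^ n \<le> l (enat a) * lam ^ n"
        using lam2 la by (intro mult_left_mono power_mono) auto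
      also have "\<dots> = (\<Sum>b\<leftarrow>subst_iter rho n (enat a). l b)"
        by (simp add: sum_list_subst_iter_eigenfunction[OF eig] mult.commute)
      also have "\<dots> \<le> (\<Sum>b\<leftarrow>subst_iter rho n (enat a). B)"
        by (intro sum_list_mono B)
      also have "\<dots> = B * real (length (subst_iter rho n (enat a)))"
        by (simp add: sum_list_triv mult.commute)
      also have "\<dots> \<le> B * (weight a * (39/20) ^ n)"
        by (intro mult_left_mono length_subst_iter_finite B0)
      finally show False using n by simp
    qed
  qed
  have "l \<infinity> = 0"
  proof (rule ccontr)
    assume "l \<infinity> \<noteq> 0"
    moreover have "open {x. l x \<noteq> 0}"
      by (intro open_Collect_neq cont continuous_on_const)
    ultimately obtain n where "{enat n<..} \<subseteq> {x. l x \<noteq> 0}" by (auto simp: open_enat_iff)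
    moreover have "enat (Suc n) \<in> {enat n<..}" by simp
    ultimately show False using fin by blast
  qed
  then have "l = (\<lambda>a. 0)" using fin by (metis not_infinity_eq)
  with nz show False ..
qed

section \<open>Bi-infinite words\<close>

text \<open>The words \<open>W n\<close> are laid over each other so that each is the middle part of
  the next. Non-empty \<open>P n\<close> and \<open>S n\<close> make them exhaust the integers, and
  every finite window of the limit lies in some \<open>W n\<close>.\<close>

lemma biinfinite_limit_word:
  fixes W P S :: "nat \<Rightarrow> 'a list"
  assumes W: "\<And>n. W (Suc n) = P n @ W n @ S n"
    and P: "\<And>n. P n \<noteq> []" and S: "\<And>n. S n \<noteq> []" and W0: "W 0 \<noteq> []"
  obtains w where "\<And>u. subword_of_biinf u w \<longleftrightarrow> (\<exists>n. sublist u (W n))"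
proof -
  \<comment> \<open>\<open>W n\<close> occupies the positions from \<open>- p n\<close> on, so that
    the first letter of \<open>W 0\<close> sits at 0.\<close>
  define p where "p n = (\<Sum>k<n. length (P k))" for n
  have p_ge: "n \<le> p n" for n
  proof (induction n)
    case (Suc n)
    moreover have "1 \<le> length (P n)" using P[of n] by (simp add: Suc_leI)
    ultimately show ?case by (simp add: p_def)
  qed simp
  \<comment> \<open>With \<open>p_ge\<close>, \<open>W n\<close> covers all positions from
    \<open>- n\<close> to \<open>n\<close>.\<close>
  have len: "p n + n < length (W n)" for n
  proof (induction n)
    case 0
    then show ?case using W0 by (simp add: p_def)
  next
    case (Suc n)
    moreover have "1 \<le> length (S n)" using S[of n] by (simp add: Suc_leI)
    ultimately show ?case by (simp add: W p_def)
  qed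
  \<comment> \<open>Later words keep the letters already placed; integers avoid truncated
    subtraction.\<close>
  have nest: "W (n + k) ! nat (int i - int (p n) + int (p (n + k))) = W n ! i \<and>
      int i - int (p n) + int (p (n + k)) < int (length (W (n + k))) \<and>
      0 \<le> int i - int (p n) + int (p (n + k))"
    if "i < length (W n)" for n k i
  proof (induction k)
    case 0
    then show ?case using that by simp
  next
    case (Suc k)
    define j where "j = nat (int i - int (p n) + int (p (n + k)))"
    have j: "int j = int i - int (p n) + int (p (n + k))" using Suc by (simp add: j_def)
    have "int i - int (p n) + int (p (n + Suc k)) = int (length (P (n + k)) + j)"
      using j by (simp add: p_def)
    moreover have jW: "j < length (W (n + k))" using Suc j by linarith
    moreover have "W (n + k) ! j = W n ! i" using Suc by (simp add: j_def)
    moreover have "int (length (P (n + k)) + j) < int (length (W (n + Suc k)))"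
      using jW by (simp add: W)
    ultimately show ?case by (simp add: W nth_append del: of_nat_add)
  qed
  define m where "m i = Suc (nat \<bar>i\<bar>)" for i :: int
  define w where "w i = W (m i) ! nat (i + int (p (m i)))" for i
  have w: "w (int i - int (p n)) = W n ! i" if i: "i < length (W n)" for n i
  proof -
    define j where "j = int i - int (p n)"
    define i' where "i' = nat (j + int (p (m j)))"
    have "0 \<le> j + int (p (m j))" using p_ge[of "m j"] by (simp add: m_def)
    then have i': "int i' - int (p (m j)) = j" by (simp add: i'_def)
    moreover have "j < int (m j)" by (simp add: m_def)
    ultimately have "i' < length (W (m j))" using len[of "m j"] by linarith
    \<comment> \<open>Both \<open>W (m j)\<close> and \<open>W n\<close> are compared inside
      \<open>W (n + m j)\<close>.\<close>
    from nest[OF this, of n] nest[OF i, of "m j"] i'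
    show ?thesis by (simp add: w_def i'_def j_def add.commute)
  qed
  have "subword_of_biinf u w \<longleftrightarrow> (\<exists>n. sublist u (W n))" for u
  proof
    assume "subword_of_biinf u w"
    then obtain i where u: "\<And>k. k < length u \<Longrightarrow> u ! k = w (i + int k)"
      by (auto simp: subword_of_biinf_def)
    \<comment> \<open>For this \<open>n\<close> the window occupied by \<open>u\<close> lies between
      \<open>- n\<close> and \<open>n\<close>.\<close>
    define n where "n = nat \<bar>i\<bar> + length u"
    define j where "j = nat (i + int (p n))"
    have "0 \<le> i + int (p n)" using p_ge[of n] by (simp add: n_def)
    then have j: "int j - int (p n) = i" by (simp add: j_def)
    moreover have "i + int (length u) \<le> int n" by (simp add: n_def)
    ultimately have jl: "j + length u \<le> length (W n)" using len[of n] by linarith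
    have "u = take (length u) (drop j (W n))"
    proof (rule nth_equalityI)
      show "length u = length (take (length u) (drop j (W n)))" using jl by simp
    next
      fix k assume k: "k < length u"
      have "w (int (j + k) - int (p n)) = W n ! (j + k)" using k jl by (intro w) simp
      moreover have "int (j + k) - int (p n) = i + int k" using j by simp
      ultimately have "w (i + int k) = W n ! (j + k)" by (simp only:)
      then show "u ! k = take (length u) (drop j (W n)) ! k" using u[OF k] k jl by simp
    qed
    then have "sublist u (W n)"
      by (metis sublist_drop sublist_take sublist_order.order_trans)
    then show "\<exists>n. sublist u (W n)" ..
  next
    assume "\<exists>n. sublist u (W n)"
    then obtain n ys zs where eq: "W n = ys @ u @ zs" by (auto simp: sublist_def)
    have "u ! k = w ((int (length ys) - int (p n)) + int k)" if "k < length u" for k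
    proof -
      have "w (int (length ys + k) - int (p n)) = W n ! (length ys + k)"
        using that eq by (intro w) simp
      then show ?thesis using that eq by (simp add: nth_append algebra_simps)
    qed
    then show "subword_of_biinf u w" unfolding subword_of_biinf_def by blast
  qed
  then show ?thesis by (rule that)
qed

section \<open>Translates and a suitable point of the subshift\<close>

lemma translate_in_subshift:
  assumes "w \<in> subshift \<rho>"
  shows "(\<lambda>k. w (k + j)) \<in> subshift \<rho>"
proof -
  have "subword_of_biinf u w" if "subword_of_biinf u (\<lambda>k. w (k + j))" for u
    using that unfolding subword_of_biinf_def by (metis add.assoc add.commute)
  then show ?thesis using assms by (auto simp: subshift_def)
qed

lemma shift_in_subshift: "w \<in> subshift \<rho> \<Longrightarrow> shift w \<in> subshift \<rho>"
  unfolding shift_def by (rule translate_in_subshift)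

lemma funpow_shift: "(shift ^^ n) w = (\<lambda>k. w (k + int n))"
  by (induction n) (auto simp: shift_def algebra_simps)

lemma subst_iter_sublist_language: "sublist u (subst_iter \<rho> n a) \<Longrightarrow> u \<in> language \<rho>"
  unfolding language_def by (rule subsetD[OF closure_of_subset]) auto

text \<open>One point serves both families of averages. It is the limit of
  \<open>rho^(2n)(\<infinity>)\<close>, which reappears in the interior of
  \<open>rho^(2n+2)(\<infinity>)\<close>; each \<open>rho^n(0)\<close> is a prefix of
  \<open>rho^(n+1)(\<infinity>)\<close>.\<close>

lemma subshift_rho_word:
  obtains w where "w \<in> subshift rho"
    "\<And>n. subword_of_biinf (subst_iter rho n 0) w"
    "\<And>n. subword_of_biinf (subst_iter rho n \<infinity>) w"
proof -
  define W where "W n = subst_iter rho (2 * n) \<infinity>" for n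
  define P where "P n = subst_iter rho (Suc (2 * n)) 0 @ subst_iter rho (2 * n) 0" for n
  define S where "S n = subst_iter rho (2 * n) \<infinity> @ subst_iter rho (Suc (2 * n)) \<infinity>" for n
  have "W (Suc n) = P n @ W n @ S n" for n
    by (simp add: W_def P_def S_def subst_iter_infinity_Suc)
  moreover have "P n \<noteq> []" "S n \<noteq> []" "W 0 \<noteq> []" for n
    by (simp_all add: P_def S_def W_def subst_iter_nonempty)
  ultimately obtain w where w: "\<And>u. subword_of_biinf u w \<longleftrightarrow> (\<exists>n. sublist u (W n))"
    using biinfinite_limit_word[of W P S] by blast
  have inf: "sublist (subst_iter rho n \<infinity>) (subst_iter rho (n + k) \<infinity>)" for n k
  proof (induction k)
    case (Suc k)
    have "sublist (subst_iter rho (n + k) \<infinity>) (subst_iter rho (n + Suc k) \<infinity>)"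
      by (simp add: subst_iter_infinity_Suc)
    with Suc show ?case by (meson sublist_order.order_trans)
  qed simp
  have infW: "sublist (subst_iter rho n \<infinity>) (W n)" for n
    using inf[of n n] by (simp add: W_def mult_2)
  have zero: "sublist (subst_iter rho n 0) (W (Suc n))" for n
  proof (rule sublist_order.order_trans)
    show "sublist (subst_iter rho n 0) (subst_iter rho (Suc n) \<infinity>)"
      by (simp add: subst_iter_infinity_Suc)
  qed (rule infW)
  show ?thesis
  proof (rule that)
    show "w \<in> subshift rho"
      using subst_iter_sublist_language by (fastforce simp: subshift_def w W_def)
  qed (use w infW zero in blast)+
qed

section \<open>Limits of empirical measures\<close>

lemma mspace_C_space:
  "f \<in> mspace (C_space X) \<longleftrightarrow> f \<in> extensional X \<and> bounded (f ` X) \<and> continuous_on X f"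
  by (auto simp: C_space_def)

lemma C_space_restrictI:
  assumes "bounded (f ` X)" "continuous_on X f"
  shows "restrict f X \<in> mspace (C_space X)"
proof -
  have "restrict f X ` X = f ` X" by auto
  moreover have "continuous_on X (restrict f X)"
    using assms(2) by (rule continuous_on_eq) simp
  ultimately show ?thesis using assms(1) by (simp add: mspace_C_space)
qed

lemma C_space_dist_le:
  assumes "f \<in> mspace (C_space X)" "g \<in> mspace (C_space X)" "x \<in> X"
  shows "\<bar>f x - g x\<bar> \<le> mdist (C_space X) f g"
  using mdist_cfunspace_imp_mdist_le[of f "top_of_set X" euclidean_metric g, OF _ _ order_refl] assms
  by (simp add: C_space_def dist_real_def)

lemma continuous_on_shift: "continuous_on S (shift :: (int \<Rightarrow> 'a::topological_space) \<Rightarrow> _)"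
  unfolding shift_def
  by (intro continuous_on_coordinatewise_then_product
      continuous_on_subset[OF continuous_on_product_coordinates subset_UNIV])

text \<open>
  The limit is taken along a filter finer than the sequence of empirical functionals; it exists
  by Tychonoff's theorem, as in the proof of the Banach--Alaoglu theorem.
\<close>
lemma empirical_limit:
  fixes X :: "(int \<Rightarrow> 'a::topological_space) set" and x :: "nat \<Rightarrow> int \<Rightarrow> 'a" and L :: "nat \<Rightarrow> nat"
  assumes shift: "\<And>w. w \<in> X \<Longrightarrow> shift w \<in> X" and x: "\<And>k. x k \<in> X"
    and pos: "\<And>k. 0 < L k" and L: "filterlim L at_top sequentially"
  shows "\<exists>\<mu>. invariant_prob X \<mu> \<and>
    (\<forall>f\<in>mspace (C_space X). \<forall>T. closed T \<and>
      (\<forall>k. (\<Sum>i<L k. f ((shift ^^ i) (x k))) / real (L k) \<in> T) \<longrightarrow> \<mu> f \<in> T)"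
proof -
  define C where "C = mspace (C_space X)"
  define A where "A k = restrict (\<lambda>f. (\<Sum>i<L k. f ((shift ^^ i) (x k))) / real (L k)) C" for k
  have A_apply: "A k f = (\<Sum>i<L k. f ((shift ^^ i) (x k))) / real (L k)" if "f \<in> C" for k f
    using that by (simp add: A_def)
  have orbit: "(shift ^^ i) (x k) \<in> X" for i k
    by (induction i) (use shift x in auto)
  have "\<exists>B. \<forall>y\<in>X. \<bar>f y\<bar> \<le> B" if "f \<in> C" for f
    using that by (auto simp: C_def mspace_C_space bounded_iff)
  then obtain B where B: "\<And>f y. f \<in> C \<Longrightarrow> y \<in> X \<Longrightarrow> \<bar>f y\<bar> \<le> B f" by metis
  have avg_le: "(\<Sum>i<L k. h i) / real (L k) \<le> b" if "\<And>i. h i \<le> b" for h :: "nat \<Rightarrow> real" and b k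
  proof -
    have "(\<Sum>i<L k. h i) \<le> (\<Sum>i<L k. b)" by (intro sum_mono that)
    then show ?thesis using pos[of k] by (simp add: field_simps)
  qed
  have avg_abs: "\<bar>(\<Sum>i<L k. h i) / real (L k)\<bar> \<le> b" if "\<And>i. \<bar>h i\<bar> \<le> b"
    for h :: "nat \<Rightarrow> real" and b k
  proof -
    have "\<bar>(\<Sum>i<L k. h i) / real (L k)\<bar> \<le> (\<Sum>i<L k. \<bar>h i\<bar>) / real (L k)"
      using sum_abs[of h "{..<L k}"] by (simp add: divide_right_mono)
    also have "\<dots> \<le> b" by (rule avg_le) (rule that)
    finally show ?thesis .
  qed
  \<comment> \<open>A compact box containing all \<open>A k\<close>. The singleton factors off
    \<open>C\<close> make every point of the box extensional.\<close>
  define K where "K = Pi\<^sub>E UNIV (\<lambda>f. if f \<in> C then cball 0 (B f) else {undefined :: real})"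
  have "compactin (product_topology (\<lambda>_. euclidean) UNIV) K"
    unfolding K_def compactin_PiE by (simp add: compactin_euclidean_iff)
  then have "compact K" by (simp add: euclidean_product_topology)
  moreover have "A k \<in> K" for k
    using avg_abs[OF B[OF _ orbit]] by (auto simp: K_def A_def)
  moreover have "filtermap A sequentially \<noteq> bot" by (simp add: filtermap_bot_iff)
  ultimately obtain \<mu> where "\<mu> \<in> K" and nonbot: "inf (nhds \<mu>) (filtermap A sequentially) \<noteq> bot"
    unfolding compact_filter by (fastforce simp: eventually_filtermap)
  define G where "G = inf (nhds \<mu>) (filtermap A sequentially)"
  have G: "G \<noteq> bot" using nonbot by (simp add: G_def)
  \<comment> \<open>What holds for every \<open>A k\<close> holds along \<open>G\<close>; closed
    conditions on finitely many values then pass to \<open>\<mu>\<close>.\<close>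
  have ev: "eventually P G" if "\<And>k. P (A k)" for P
  proof -
    have "eventually P (filtermap A sequentially)" using that by (simp add: eventually_filtermap)
    then show ?thesis unfolding G_def by (metis filter_leD inf_le2)
  qed
  have lim: "((\<lambda>\<phi>. \<phi> f) \<longlongrightarrow> \<mu> f) G" for f
  proof (rule tendsto_mono)
    show "G \<le> nhds \<mu>" by (simp add: G_def)
    show "((\<lambda>\<phi>. \<phi> f) \<longlongrightarrow> \<mu> f) (nhds \<mu>)"
    proof (rule topological_tendstoI)
      fix S assume S: "open S" "\<mu> f \<in> S"
      have "open {\<phi> :: ((int \<Rightarrow> 'a) \<Rightarrow> real) \<Rightarrow> real. \<phi> f \<in> S}"
        using open_vimage[OF S(1) continuous_on_product_coordinates[of f]] by (simp add: vimage_def)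
      then show "eventually (\<lambda>\<phi>. \<phi> f \<in> S) (nhds \<mu>)" using S(2) by (auto simp: eventually_nhds)
    qed
  qed
  have closed_lim: "c \<in> T" if "(h \<longlongrightarrow> c) G" "\<And>k. h (A k) \<in> T" "closed T"
    for h :: "_ \<Rightarrow> real" and c T
    by (rule Lim_in_closed_set[OF that(3) ev[of "\<lambda>\<phi>. h \<phi> \<in> T", OF that(2)] G that(1)])
  have inT: "\<mu> f \<in> T" if "closed T" "\<And>k. A k f \<in> T" for f T
    by (rule closed_lim[OF lim that(2,1)])
  have add: "\<mu> (restrict (\<lambda>y. f y + g y) X) = \<mu> f + \<mu> g" if f: "f \<in> C" and g: "g \<in> C" for f g
  proof -
    define s where "s = restrict (\<lambda>y. f y + g y) X"
    have "bounded ((\<lambda>y. f y + g y) ` X)"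
      using f g by (intro bounded_plus_comp) (auto simp: C_def mspace_C_space)
    then have s: "s \<in> C"
      using f g unfolding s_def C_def
      by (intro C_space_restrictI continuous_intros) (auto simp: mspace_C_space)
    have "((\<lambda>\<phi>. \<phi> s - (\<phi> f + \<phi> g)) \<longlongrightarrow> \<mu> s - (\<mu> f + \<mu> g)) G"
      by (intro tendsto_intros lim)
    moreover have "A k s - (A k f + A k g) \<in> {0}" for k
    proof -
      have "s ((shift ^^ i) (x k)) = f ((shift ^^ i) (x k)) + g ((shift ^^ i) (x k))" for i
        by (simp add: s_def orbit)
      then show ?thesis by (simp add: A_apply f g s sum.distrib add_divide_distrib)
    qed
    ultimately have "\<mu> s - (\<mu> f + \<mu> g) \<in> {0}"
      by (rule closed_lim) simp
    then show ?thesis by (simp add: s_def)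
  qed
  have scale: "\<mu> (restrict (\<lambda>y. c * f y) X) = c * \<mu> f" if f: "f \<in> C" for f c
  proof -
    define s where "s = restrict (\<lambda>y. c * f y) X"
    have "bounded ((\<lambda>y. c *\<^sub>R f y) ` X)"
      using f by (intro bounded_scaleR_comp) (auto simp: C_def mspace_C_space)
    then have s: "s \<in> C"
      using f unfolding s_def C_def
      by (intro C_space_restrictI continuous_intros) (auto simp: mspace_C_space)
    have "((\<lambda>\<phi>. \<phi> s - c * \<phi> f) \<longlongrightarrow> \<mu> s - c * \<mu> f) G" by (intro tendsto_intros lim)
    moreover have "A k s - c * A k f \<in> {0}" for k
    proof -
      have "s ((shift ^^ i) (x k)) = c * f ((shift ^^ i) (x k))" for i
        by (simp add: s_def orbit)
      then show ?thesis by (simp add: A_apply f s flip: sum_distrib_left)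
    qed
    ultimately have "\<mu> s - c * \<mu> f \<in> {0}"
      by (rule closed_lim) simp
    then show ?thesis by (simp add: s_def)
  qed
  have lipschitz: "\<bar>\<mu> f - \<mu> g\<bar> \<le> mdist (C_space X) f g" if f: "f \<in> C" and g: "g \<in> C" for f g
  proof -
    define D where "D = mdist (C_space X) f g"
    have "((\<lambda>\<phi>. \<bar>\<phi> f - \<phi> g\<bar>) \<longlongrightarrow> \<bar>\<mu> f - \<mu> g\<bar>) G" by (intro tendsto_intros lim)
    moreover have "\<bar>A k f - A k g\<bar> \<in> {..D}" for k
    proof -
      have "\<bar>(\<Sum>i<L k. f ((shift ^^ i) (x k)) - g ((shift ^^ i) (x k))) / real (L k)\<bar> \<le> D"
        using f g orbit unfolding D_def C_def by (intro avg_abs C_space_dist_le)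
      then show ?thesis by (simp add: A_apply f g sum_subtractf diff_divide_distrib)
    qed
    ultimately have "\<bar>\<mu> f - \<mu> g\<bar> \<in> {..D}"
      by (rule closed_lim) simp
    then show ?thesis by (simp add: D_def)
  qed
  have invariant: "\<mu> (restrict (f \<circ> shift) X) = \<mu> f" if f: "f \<in> C" for f
  proof -
    define s where "s = restrict (f \<circ> shift) X"
    have "bounded ((f \<circ> shift) ` X)"
      by (rule bounded_subset[of "f ` X"]) (use f shift in \<open>auto simp: C_def mspace_C_space\<close>)
    moreover have "continuous_on X (f \<circ> shift)"
      using f shift
      by (intro continuous_on_compose[OF continuous_on_shift continuous_on_subset[of X f]])
        (auto simp: C_def mspace_C_space)
    ultimately have s: "s \<in> C" unfolding s_def C_def by (rule C_space_restrictI)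
    \<comment> \<open>The two sums telescope to two boundary terms. Invariance therefore holds only
      in the limit and is where \<open>L\<close> must tend to infinity.\<close>
    have diff: "\<bar>A k s - A k f\<bar> \<le> 2 * B f / real (L k)" for k
    proof -
      have "(\<Sum>i<L k. s ((shift ^^ i) (x k))) - (\<Sum>i<L k. f ((shift ^^ i) (x k))) =
          (\<Sum>i<L k. f ((shift ^^ Suc i) (x k)) - f ((shift ^^ i) (x k)))"
        using orbit by (simp add: s_def sum_subtractf)
      also have "\<dots> = f ((shift ^^ L k) (x k)) - f (x k)"
        by (subst sum_lessThan_telescope) simp
      finally have "A k s - A k f = (f ((shift ^^ L k) (x k)) - f (x k)) / real (L k)"
        by (simp add: A_apply f s flip: diff_divide_distrib)
      moreover have "\<bar>f ((shift ^^ L k) (x k)) - f (x k)\<bar> \<le> 2 * B f"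
        using B[OF f orbit, of "L k" k] B[OF f x, of k] by linarith
      ultimately show ?thesis by (simp add: divide_right_mono)
    qed
    have "(\<lambda>k. 2 * B f / real (L k)) \<longlonglongrightarrow> 0"
      by (intro tendsto_divide_0[OF tendsto_const] filterlim_at_top_imp_at_infinity
          filterlim_compose[OF filterlim_real_sequentially L])
    then have "(\<lambda>k. A k s - A k f) \<longlonglongrightarrow> 0"
      by (rule Lim_null_comparison[rotated]) (use diff in \<open>auto intro!: always_eventually\<close>)
    then have "((\<lambda>\<phi>. \<phi> s - \<phi> f) \<longlongrightarrow> 0) (filtermap A sequentially)"
      by (simp add: filterlim_filtermap)
    then have "((\<lambda>\<phi>. \<phi> s - \<phi> f) \<longlongrightarrow> 0) G"
      by (rule tendsto_mono[rotated]) (simp add: G_def)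
    moreover have "((\<lambda>\<phi>. \<phi> s - \<phi> f) \<longlongrightarrow> \<mu> s - \<mu> f) G" by (intro tendsto_intros lim)
    ultimately have "\<mu> s - \<mu> f = 0" by (rule tendsto_unique[OF G, rotated])
    then show ?thesis by (simp add: s_def)
  qed
  have nonneg: "0 \<le> \<mu> f" if "f \<in> C" "\<forall>y\<in>X. 0 \<le> f y" for f
  proof -
    have "\<mu> f \<in> {0..}"
      using that orbit by (intro inT) (auto simp: A_def intro!: divide_nonneg_nonneg sum_nonneg)
    then show ?thesis by simp
  qed
  have unit: "\<mu> (restrict (\<lambda>y. 1) X) = 1"
  proof -
    have "restrict (\<lambda>y. 1) X \<in> C"
      unfolding C_def by (intro C_space_restrictI) (auto simp: image_constant_conv)
    then have "\<mu> (restrict (\<lambda>y. 1) X) \<in> {1}"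
      using orbit pos by (intro inT) (auto simp: A_def)
    then show ?thesis by simp
  qed
  \<comment> \<open>Averages are 1-Lipschitz for the sup metric, and so is their limit.\<close>
  have "Lipschitz_continuous_map (C_space X) euclidean_metric \<mu>"
    unfolding Lipschitz_continuous_map_def using lipschitz
    by (auto simp: dist_real_def C_def intro!: exI[of _ 1])
  then have "continuous_map (mtopology_of (C_space X)) euclideanreal \<mu>"
    using Lipschitz_continuous_imp_continuous_map by fastforce
  moreover have "\<mu> \<in> extensional C"
    using \<open>\<mu> \<in> K\<close> by (auto simp: K_def extensional_def PiE_iff split: if_splits)
  ultimately have "invariant_prob X \<mu>"
    using add scale nonneg unit invariant
    by (simp add: invariant_prob_def measure_functional_def flip: C_def)
  moreover have "\<mu> f \<in> T"
    if "f \<in> mspace (C_space X)" "closed T"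
      "\<And>k. (\<Sum>i<L k. f ((shift ^^ i) (x k))) / real (L k) \<in> T" for f T
    using that by (intro inT) (auto simp: A_def C_def)
  ultimately show ?thesis by blast
qed

section \<open>Failure of unique ergodicity\<close>

text \<open>Otherwise \<open>f\<close> would grow at most like \<open>q ^ n\<close> from some index
  on, against the lower bound with \<open>r > q\<close>.\<close>

lemma infinite_large_ratios:
  fixes f :: "nat \<Rightarrow> real"
  assumes lower: "\<And>n. c * r ^ n \<le> f n" and "0 < c" "0 < q" "q < r"
  shows "infinite {n. q * f n \<le> f (Suc n)}"
proof
  assume "finite {n. q * f n \<le> f (Suc n)}"
  then obtain N where "\<forall>n\<in>{n. q * f n \<le> f (Suc n)}. n < N"
    unfolding finite_nat_set_iff_bounded by blast
  then have N: "f (Suc n) < q * f n" if "n \<ge> N" for n using that by (meson mem_Collect_eq not_le)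
  have decay: "f (N + k) \<le> f N * q ^ k" for k
  proof (induction k)
    case (Suc k)
    have "f (N + Suc k) \<le> q * f (N + k)" using N[of "N + k"] by simp
    also have "\<dots> \<le> q * (f N * q ^ k)" using Suc \<open>0 < q\<close> by (intro mult_left_mono) auto
    finally show ?case by (simp add: mult_ac)
  qed simp
  have "0 < c * r ^ N" using assms by simp
  then obtain k where "f N * q ^ k < (c * r ^ N) * r ^ k"
    using no_exponential_domination[of q r "c * r ^ N" "f N"] assms by blast
  then show False using lower[of "N + k"] decay[of k] by (simp add: power_add mult.assoc)
qed

text \<open>Dually, ratios above \<open>q\<close> from some index on would force growth at least
  like \<open>q ^ n\<close>, against the upper bound with \<open>r < q\<close>.\<close>

lemma infinite_small_ratios:
  fixes f :: "nat \<Rightarrow> real"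
  assumes upper: "\<And>n. f n \<le> c * r ^ n" and pos: "\<And>n. 0 < f n" and "0 < r" "r < q"
  shows "infinite {n. f (Suc n) \<le> q * f n}"
proof
  assume "finite {n. f (Suc n) \<le> q * f n}"
  then obtain N where "\<forall>n\<in>{n. f (Suc n) \<le> q * f n}. n < N"
    unfolding finite_nat_set_iff_bounded by blast
  then have N: "q * f n < f (Suc n)" if "n \<ge> N" for n using that by (meson mem_Collect_eq not_le)
  have growth: "f N * q ^ k \<le> f (N + k)" for k
  proof (induction k)
    case (Suc k)
    have "q * (f N * q ^ k) \<le> q * f (N + k)" using Suc assms by (intro mult_left_mono) auto
    also have "\<dots> \<le> f (N + Suc k)" using N[of "N + k"] by simp
    finally show ?case by (simp add: mult_ac)
  qed simp
  obtain k where "(c * r ^ N) * r ^ k < f N * q ^ k"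
    using no_exponential_domination[of r q "f N" "c * r ^ N"] assms by blast
  then show False using upper[of "N + k"] growth[of k] by (simp add: power_add mult.assoc)
qed

text \<open>The length is 1 on the clopen set \<open>{0, 1}\<close> and 3 on its complement.\<close>

lemma continuous_length_rho: "continuous_on UNIV (\<lambda>a. real (length (rho a)))"
proof -
  have rho_len: "real (length (rho a)) = (if a < 2 then 1 else 3)" for a
  proof (cases a)
    case (enat b)
    then show ?thesis by (auto simp: rho_def numeral_eq_enat)
  qed (simp add: rho_infinity)
  have "- {..<2::enat} = {1<..}"
  proof -
    have "2 \<le> x \<longleftrightarrow> 1 < x" for x :: enat
      by (cases x) (auto simp: numeral_eq_enat one_enat_def)
    then show ?thesis by (auto simp: not_less)
  qed
  then have op: "open {..<2::enat}" "open (- {..<2::enat})" by simp_all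
  have "continuous_on ({..<2} \<union> - {..<2::enat}) (\<lambda>a. real (length (rho a)))"
  proof (rule continuous_on_open_Un[OF op])
    show "continuous_on {..<2} (\<lambda>a. real (length (rho a)))"
      by (rule continuous_on_eq[OF continuous_on_const[of _ 1]]) (simp add: rho_len)
    show "continuous_on (- {..<2}) (\<lambda>a. real (length (rho a)))"
      by (rule continuous_on_eq[OF continuous_on_const[of _ 3]]) (simp add: rho_len)
  qed
  then show ?thesis unfolding Compl_partition .
qed

text \<open>The observable separating the two measures. The restriction gives it the form of an
  element of \<open>C_space\<close>.\<close>

definition first_image_length :: "(int \<Rightarrow> enat) \<Rightarrow> real" where
  "first_image_length = restrict (\<lambda>x. real (length (rho (x 0)))) (subshift rho)"

lemma first_image_length_in_C_space: "first_image_length \<in> mspace (C_space (subshift rho))"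
  unfolding first_image_length_def
proof (rule C_space_restrictI)
  have "\<bar>real (length (rho a))\<bar> \<le> 3" for a
    by (cases a) (auto simp: rho_def)
  then show "bounded ((\<lambda>x. real (length (rho (x 0)))) ` subshift rho)"
    by (auto simp: bounded_iff intro!: exI[of _ 3])
  show "continuous_on (subshift rho) (\<lambda>x. real (length (rho (x 0))))"
    by (rule continuous_on_compose2[OF continuous_length_rho
          continuous_on_subset[OF continuous_on_product_coordinates subset_UNIV] subset_UNIV])
qed

text \<open>Summing \<open>length (rho b)\<close> over the letters \<open>b\<close> of
  \<open>rho^n(a)\<close> gives the length of \<open>rho^(n+1)(a)\<close>, so the empirical average
  is \<open>f (Suc n) / f n\<close>. Restricting to those \<open>n\<close> with ratio in the closed
  set \<open>T\<close> keeps the limit in \<open>T\<close>.\<close>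

lemma invariant_prob_from_ratios:
  fixes a :: enat
  defines "f \<equiv> \<lambda>n. real (length (subst_iter rho n a))"
  assumes w: "w \<in> subshift rho" "\<And>n. subword_of_biinf (subst_iter rho n a) w"
    and len: "filterlim (\<lambda>n. length (subst_iter rho n a)) at_top sequentially"
    and inf: "infinite {n. f (Suc n) / f n \<in> T}" and T: "closed T"
  obtains \<mu> where "invariant_prob (subshift rho) \<mu>" "\<mu> first_image_length \<in> T"
proof -
  obtain r :: "nat \<Rightarrow> nat" where r: "strict_mono r" and rT: "\<And>k. f (Suc (r k)) / f (r k) \<in> T"
    using infinite_enumerate[OF inf] by auto
  have "\<forall>n. \<exists>p. \<forall>i<length (subst_iter rho n a). subst_iter rho n a ! i = w (p + int i)"
    using w(2) by (simp add: subword_of_biinf_def)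
  from choice[OF this] obtain p where p: "\<And>n i. i < length (subst_iter rho n a) \<Longrightarrow>
      subst_iter rho n a ! i = w (p n + int i)"
    by blast
  \<comment> \<open>The translate moves an occurrence of \<open>rho^(r k)(a)\<close> to position 0,
    where its orbit average starts.\<close>
  define x where "x k = (\<lambda>j. w (j + p (r k)))" for k
  define L where "L k = length (subst_iter rho (r k) a)" for k
  have x: "x k \<in> subshift rho" for k
    unfolding x_def by (rule translate_in_subshift[OF w(1)])
  have pos: "0 < L k" for k using subst_iter_nonempty by (simp add: L_def)
  have L: "filterlim L at_top sequentially"
    unfolding L_def by (rule filterlim_compose[OF len filterlim_subseq[OF r]])
  obtain \<mu> where \<mu>: "invariant_prob (subshift rho) \<mu>"
    and lim: "\<forall>g\<in>mspace (C_space (subshift rho)). \<forall>T. closed T \<and>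
      (\<forall>k. (\<Sum>i<L k. g ((shift ^^ i) (x k))) / real (L k) \<in> T) \<longrightarrow> \<mu> g \<in> T"
    using empirical_limit[of "subshift rho" x L, OF shift_in_subshift x pos L] by blast
  have "(\<Sum>i<L k. first_image_length ((shift ^^ i) (x k))) / real (L k) = f (Suc (r k)) / f (r k)" for k
  proof -
    have "first_image_length ((shift ^^ i) (x k)) = real (length (rho (subst_iter rho (r k) a ! i)))"
      if "i < L k" for i
    proof -
      have "(shift ^^ i) (x k) \<in> subshift rho"
        unfolding funpow_shift by (rule translate_in_subshift[OF x])
      then show ?thesis
        using p[of i "r k"] that
        by (simp add: first_image_length_def funpow_shift x_def L_def add.commute)
    qed
    then have "(\<Sum>i<L k. first_image_length ((shift ^^ i) (x k))) =
        real (\<Sum>i<L k. length (rho (subst_iter rho (r k) a ! i)))" by simp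
    also have "\<dots> = f (Suc (r k))"
      by (simp add: f_def subst_iter_Suc' length_concat sum_list_sum_nth L_def atLeast0LessThan)
    finally show ?thesis by (simp add: f_def L_def)
  qed
  then have "\<mu> first_image_length \<in> T"
    using rT by (intro lim[rule_format] first_image_length_in_C_space conjI T) simp
  with \<mu> show ?thesis by (rule that)
qed

lemma not_uniquely_ergodic_rho: "\<not> uniquely_ergodic (subshift rho)"
proof
  assume unique: "uniquely_ergodic (subshift rho)"
  define f where "f a n = real (length (subst_iter rho n a))" for a n
  have fpos: "0 < f a n" for a n using subst_iter_nonempty by (simp add: f_def)
  obtain w where w: "w \<in> subshift rho" "\<And>n. subword_of_biinf (subst_iter rho n 0) w"
    "\<And>n. subword_of_biinf (subst_iter rho n \<infinity>) w"
    using subshift_rho_word by blast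
  \<comment> \<open>The constant lies below the growth rate 2 at \<infinity> and above the constant
    49/25 used for the letter 0.\<close>
  have large: "infinite {n. 199/100 * f \<infinity> n \<le> f \<infinity> (Suc n)}"
  proof (rule infinite_large_ratios[of 1 2])
    have "(2::real) ^ n \<le> f \<infinity> n" for n
      using of_nat_mono[OF length_subst_iter_infinity[of n], where 'a = real] by (simp add: f_def)
    then show "1 * 2 ^ n \<le> f \<infinity> n" for n by simp
  qed simp_all
  have len_inf: "filterlim (\<lambda>n. length (subst_iter rho n \<infinity>)) at_top sequentially"
  proof (rule filterlim_at_top_mono[OF filterlim_ident])
    have "n \<le> length (subst_iter rho n \<infinity>)" for n
      using length_subst_iter_infinity[of n] less_exp[of n] by linarith
    then show "\<forall>\<^sub>F n in sequentially. n \<le> length (subst_iter rho n \<infinity>)" by simp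
  qed
  have "infinite {n. f \<infinity> (Suc n) / f \<infinity> n \<in> {199/100..}}"
    using large fpos by (simp add: le_divide_eq)
  then obtain \<mu> where \<mu>: "invariant_prob (subshift rho) \<mu>"
    "\<mu> first_image_length \<in> {199/100..}"
    unfolding f_def by (rule invariant_prob_from_ratios[OF w(1) w(3) len_inf _ closed_atLeast])
  \<comment> \<open>Here 49/25 = 1.96 lies strictly between the growth bound 39/20 and 199/100, so
    the two closed half-lines are disjoint.\<close>
  have small: "infinite {n. f 0 (Suc n) \<le> 49/25 * f 0 n}"
  proof (rule infinite_small_ratios[of _ "weight 0" "39/20"])
    show "f 0 n \<le> weight 0 * (39/20) ^ n" for n
      using length_subst_iter_finite[of n 0] by (simp only: f_def zero_enat_def)
  qed (simp_all add: fpos)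
  have len_0: "filterlim (\<lambda>n. length (subst_iter rho n 0)) at_top sequentially"
  proof (rule filterlim_at_top_mono)
    show "filterlim (\<lambda>n::nat. n div 3) at_top sequentially"
      by (rule filterlim_at_top_div_const_nat) simp
    have "n div 3 \<le> length (subst_iter rho n 0)" for n
      using length_subst_iter_0_lower[of n] by linarith
    then show "\<forall>\<^sub>F n in sequentially. n div 3 \<le> length (subst_iter rho n 0)" by simp
  qed
  have "infinite {n. f 0 (Suc n) / f 0 n \<in> {..49/25}}"
    using small fpos by (simp add: divide_le_eq)
  then obtain \<nu> where \<nu>: "invariant_prob (subshift rho) \<nu>"
    "\<nu> first_image_length \<in> {..49/25}"
    unfolding f_def by (rule invariant_prob_from_ratios[OF w(1) w(2) len_0 _ closed_atMost])
  have "\<mu> = \<nu>" using unique \<mu>(1) \<nu>(1) unfolding uniquely_ergodic_def by blast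
  then show False using \<mu>(2) \<nu>(2) by simp
qed

theorem theorem4p1:
  shows "substitution rho \<and>
    (\<forall>a::nat. \<exists>c::real. c \<ge> 1 \<and>
       (\<forall>n::nat. real (length (subst_iter rho n (enat a))) \<le> c * (39/20) ^ n)) \<and>
    (\<forall>n::nat. length (subst_iter rho n \<infinity>) \<ge> 2 ^ n) \<and>
    primitive rho \<and>
    \<not> (\<exists>l. natural_length_function rho l) \<and>
    \<not> uniquely_ergodic (subshift rho)"
proof (intro conjI)
  show "\<forall>a::nat. \<exists>c::real. c \<ge> 1 \<and>
      (\<forall>n::nat. real (length (subst_iter rho n (enat a))) \<le> c * (39/20) ^ n)"
  proof
    fix a
    show "\<exists>c\<ge>1. \<forall>n. real (length (subst_iter rho n (enat a))) \<le> c * (39/20) ^ n"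
      by (intro exI[of _ "weight a"] conjI allI weight_ge_1 length_subst_iter_finite)
  qed
  show "\<not> (\<exists>l. natural_length_function rho l)" using no_natural_length_function by blast
qed (intro allI substitution_rho length_subst_iter_infinity primitive_rho
    not_uniquely_ergodic_rho)+

end
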